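(* Let $\vec U$ be a universe of separations and $\vec S\subseteq\vec U$ a submodular separation system. Let $\mathcal F\subseteq 2^{\vec U}$ be a set of stars which is standard for $\vec S$ and closed under shifting (in $\vec S$). Then exactly one of the following holds: (i) There exists an $\mathcal F$-tangle of $S$. (ii) There exists an $S$-tree over $\mathcal F$.
   Context: A separation system $(\vec S,\le,{}^* )$ is a partially ordered set with an order-reversing involution $^*:\vec S\to\vec S$. Its elements are called oriented separations. An (unoriented) separation is a set $s=\{\vec s,\vec s^{\,*}\}$; $S$ denotes the set of all these. $\vec s$ is degenerate if $\vec s=\vec s^{\,*}$. A universe of separations is a separation system $\vec U$ whose partial order is a lattice (join $\vee$, meet $\wedge$). A separation system $\vec S\subseteq\vec U$ is a subset closed under $^*$, with the induced order and involution. It is submodular if for all $\vec s,\vec t\in\vec S$ at least one of $\vec s\vee\vec t$, $\vec s\wedge\vec t$ (computed in $\vec U$) lies in $\vec S$. $\vec s\in\vec S$ is trivial in $\vec S$ if there is $t\in S$ whose orientations satisfy $\vec s<\vec t$ and $\vec s<\vec t^{\,*}$. A star is a set $\sigma$ of non-degenerate oriented separations such that $\vec s\le\vec t^{\,*}$ for any two distinct $\vec s,\vec t\in\sigma$. $\mathcal F$ is standard for $\vec S$ if $\{\vec s^{\,*}\}\in\mathcal F$ for every $\vec s\in\vec S$ trivial in $\vec S$. $\vec s\in\vec S$ emulates $\vec r$ in $\vec S$ if $\vec s\ge\vec r$ and for every $\vec t\in\vec S\setminus\{\vec r^{\,*}\}$ with $\vec t\ge\vec r$ we have $\vec s\vee\vec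 t\in\vec S$. For $\vec s\in\vec S$, $\sigma\subseteq\vec S$ and $\vec x\in\sigma$ let $\sigma_{\vec x}^{\vec s}:=\{\vec x\vee\vec s\}\cup\{\vec y\wedge\vec s^{\,*}:\vec y\in\sigma\setminus\{\vec x\}\}$. $\vec s$ emulates $\vec r$ in $\vec S$ for $\mathcal F$ if $\vec s$ emulates $\vec r$ in $\vec S$ and for every star $\sigma\subseteq\vec S\setminus\{\vec r^{\,*}\}$ with $\sigma\in\mathcal F$ and every $\vec x\in\sigma$ with $\vec x\ge\vec r$ we have $\sigma_{\vec x}^{\vec s}\in\mathcal F$. $\mathcal F$ is closed under shifting (in $\vec S$) if whenever $\vec s\in\vec S$ emulates in $\vec S$ some non-trivial (in $\vec S$) and non-degenerate $\vec r\in\vec S$ with $\{\vec r^{\,*}\}\notin\mathcal F$, then it emulates $\vec r$ in $\vec S$ for $\mathcal F$. An orientation of $S$ is a set $O\subseteq\vec S$ containing exactly one of $\vec s,\vec s^{\,*}$ for every $s\in S$ (the single element, if $s$ is degenerate). It is consistent if whenever $r,s\in S$ are distinct with orientations $\vec r\le\vec s\in O$, then $\vec r^{\,*}\notin O$. An $\mathcal F$-tangle of $S$ is a consistent orientation $O$ of $S$ such that no subset of $O$ is an element of $\mathcal F$. An $S$-tree is a pair $(T,\alpha)$ of a tree $T$ and a map $\alpha$ from the set $\vec E(T)=\{(x,y): xy\in E(T)\}$ of orientations of edges of $T$ to $\vec S$ such that $\alpha(y,x)=\alpha(x,y)^*$ for all $xy\in E(T)$. It is an $S$-tree over $\mathcal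 F$ if $\alpha(F_t)\in\mathcal F$ for every node $t$ of $T$, where $F_t=\{(s,t): st\in E(T)\}$.
   Formalization: The separation system S is assumed finite and the trees of S-trees are finite; without this the claim fails (infinite S with an infinite star in F has neither tangle nor finite S-tree; with infinite trees a double ray S-tree can coexist with a tangle). *)

theory Defs
  imports "Graph_Theory.Digraph_Component"
begin

class universe = lattice +
  fixes opp :: "'a \<Rightarrow> 'a"
  assumes opp_opp: "opp (opp s) = s"
    and opp_antimono: "s \<le> t \<Longrightarrow> opp t \<le> opp s"

definition separation_system :: "'a::universe set \<Rightarrow> bool" where
  "separation_system S \<longleftrightarrow> (\<forall>s\<in>S. opp s \<in> S)"

definition submodular :: "'a::universe set \<Rightarrow> bool" where
  "submodular S \<longleftrightarrow> (\<forall>s\<in>S. \<forall>t\<in>S. sup s t \<in> S \<or> inf s t \<in> S)"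

text \<open>The unoriented separation underlying an oriented one. The set of unoriented separations
  of a separation system \<open>S\<close> (whose elements are oriented) is \<open>sep ` S\<close>.\<close>

definition sep :: "'a::universe \<Rightarrow> 'a set" where
  "sep s = {s, opp s}"

definition degenerate :: "'a::universe \<Rightarrow> bool" where
  "degenerate s \<longleftrightarrow> s = opp s"

definition trivial_in :: "'a::universe set \<Rightarrow> 'a \<Rightarrow> bool" where
  "trivial_in S s \<longleftrightarrow> s \<in> S \<and> (\<exists>t\<in>S. s < t \<and> s < opp t)"

definition star :: "'a::universe set \<Rightarrow> bool" where
  "star \<sigma> \<longleftrightarrow> (\<forall>s\<in>\<sigma>. \<not> degenerate s) \<and> (\<forall>s\<in>\<sigma>. \<forall>t\<in>\<sigma>. s \<noteq> t \<longrightarrow> s \<le> opp t)"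

definition standard :: "'a::universe set \<Rightarrow> 'a set set \<Rightarrow> bool" where
  "standard S F \<longleftrightarrow> (\<forall>s. trivial_in S s \<longrightarrow> {opp s} \<in> F)"

definition emulates :: "'a::universe set \<Rightarrow> 'a \<Rightarrow> 'a \<Rightarrow> bool" where
  "emulates S s r \<longleftrightarrow>
     s \<in> S \<and> s \<ge> r \<and> (\<forall>t \<in> S - {opp r}. t \<ge> r \<longrightarrow> sup s t \<in> S)"

definition shift :: "'a::universe set \<Rightarrow> 'a \<Rightarrow> 'a \<Rightarrow> 'a set" where
  "shift \<sigma> x s = {sup x s} \<union> {inf y (opp s) | y. y \<in> \<sigma> - {x}}"

definition emulates_for :: "'a::universe set \<Rightarrow> 'a set set \<Rightarrow> 'a \<Rightarrow> 'a \<Rightarrow> bool" where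
  "emulates_for S F s r \<longleftrightarrow>
     emulates S s r \<and>
     (\<forall>\<sigma>\<in>F. star \<sigma> \<and> \<sigma> \<subseteq> S - {opp r} \<longrightarrow> (\<forall>x\<in>\<sigma>. x \<ge> r \<longrightarrow> shift \<sigma> x s \<in> F))"

definition closed_under_shifting :: "'a::universe set \<Rightarrow> 'a set set \<Rightarrow> bool" where
  "closed_under_shifting S F \<longleftrightarrow>
     (\<forall>s\<in>S. \<forall>r\<in>S. \<not> trivial_in S r \<and> \<not> degenerate r \<and> {opp r} \<notin> F \<and> emulates S s r
        \<longrightarrow> emulates_for S F s r)"

definition orientation :: "'a::universe set \<Rightarrow> 'a set \<Rightarrow> bool" where
  "orientation S P \<longleftrightarrow> P \<subseteq> S \<and> (\<forall>s \<in> sep ` S. \<exists>!x. x \<in> s \<and> x \<in> P)"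

definition consistent :: "'a::universe set \<Rightarrow> 'a set \<Rightarrow> bool" where
  "consistent S P \<longleftrightarrow>
     (\<forall>r\<in>S. \<forall>s\<in>S. sep r \<noteq> sep s \<and> r \<le> s \<and> s \<in> P \<longrightarrow> opp r \<notin> P)"

definition tangle :: "'a::universe set \<Rightarrow> 'a set set \<Rightarrow> 'a set \<Rightarrow> bool" where
  "tangle S F P \<longleftrightarrow> orientation S P \<and> consistent S P \<and> (\<forall>\<sigma>\<subseteq>P. \<sigma> \<notin> F)"

text \<open>Finite simple graphs are the symmetric loop-free digraphs of the locale \<open>pair_graph\<close>;
  their set \<open>parcs\<close> of arcs consists of both orientations of every edge. The constant
  \<open>Digraph_Component.tree\<close> is of no use here: it counts the closed walk \<open>u, v, u\<close> along
  a single edge as a cycle, so that no symmetric digraph with an edge satisfies it.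
  A cycle of an undirected graph has length at least 3.
  The constant \<open>connected\<close> excludes the null graph.

  Trees are finite: for infinite trees an \<open>S\<close>-tree and a tangle can coexist: on the two-element
  chain \<open>S = {0, 1}\<close> with \<open>F = {{0, 1}}\<close>, the tangle \<open>{0}\<close> coexists with the double ray all of
  whose edges are labelled \<open>0\<close> in one direction and \<open>1\<close> in the other.\<close>

definition finite_tree :: "'v pair_pre_digraph \<Rightarrow> bool" where
  "finite_tree T \<longleftrightarrow>
     pair_graph T \<and> Digraph_Component.connected (with_proj T) \<and>
     \<not> (\<exists>p. pre_digraph.cycle (with_proj T) p \<and> length p \<ge> 3)"

definition S_tree ::
  "'a::universe set \<Rightarrow> 'v pair_pre_digraph \<Rightarrow> ('v \<times> 'v \<Rightarrow> 'a) \<Rightarrow> bool" where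
  "S_tree S T \<alpha> \<longleftrightarrow>
     finite_tree T \<and> (\<forall>(x, y) \<in> parcs T. \<alpha> (x, y) \<in> S \<and> \<alpha> (y, x) = opp (\<alpha> (x, y)))"

definition S_tree_over ::
  "'a::universe set \<Rightarrow> 'a set set \<Rightarrow> 'v pair_pre_digraph \<Rightarrow> ('v \<times> 'v \<Rightarrow> 'a) \<Rightarrow> bool" where
  "S_tree_over S F T \<alpha> \<longleftrightarrow>
     S_tree S T \<alpha> \<and> (\<forall>t \<in> pverts T. \<alpha> ` {(s, t) | s. (s, t) \<in> parcs T} \<in> F)"

end

theory Submission
  imports Defs
begin

text \<open>
  Read a star \<open>\<sigma> \<in> F\<close> as a clause forbidding \<open>\<sigma> \<subseteq> P\<close>. An \<open>S\<close>-tree over \<open>F\<close> is then a refutation by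
  unit propagation, whatever node is chosen as the root. If there is none, take a maximal set \<open>P\<close>
  of additional units that keeps unit propagation free of contradictions and derives everything
  below its elements. The set of derivable separations is consistent: were
  \<open>y \<le> x\<close> with \<open>x\<close> and \<open>opp y\<close> derivable, submodularity gives an \<open>s\<close> between \<open>y\<close> and \<open>x\<close> such that
  the two derivations can be shifted to derivations of \<open>s\<close> and \<open>opp s\<close>. It is also complete:
  a separation \<open>u\<close> undecided by \<open>P\<close>, minimal in a suitable sense, could be added to \<open>P\<close>, since a
  contradiction from \<open>u\<close> can be turned into a derivation of \<open>opp u\<close>.
  Conversely, a tangle orients the edges of an \<open>S\<close>-tree so that every node has an outgoing edge,
  which is impossible in a finite tree.
\<close>

section \<open>Order and De Morgan rules for the involution\<close>

lemma opp_le_iff: "opp s \<le> opp t \<longleftrightarrow> t \<le> (s::'a::universe)"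
  by (metis opp_antimono opp_opp)

lemma le_opp_iff: "s \<le> opp t \<longleftrightarrow> t \<le> opp (s::'a::universe)"
  by (metis opp_antimono opp_opp)

lemma opp_le_swap: "opp s \<le> t \<longleftrightarrow> opp t \<le> (s::'a::universe)"
  by (metis opp_antimono opp_opp)

lemma opp_eq_iff: "opp s = opp t \<longleftrightarrow> s = (t::'a::universe)"
  by (metis opp_opp)

lemma opp_sup: "opp (sup s t) = inf (opp s) (opp (t::'a::universe))"
proof (rule antisym)
  have "sup s t \<le> opp (inf (opp s) (opp t))"
    by (intro sup_least le_opp_iff[THEN iffD1, OF inf_le1] le_opp_iff[THEN iffD1, OF inf_le2])
  then show "inf (opp s) (opp t) \<le> opp (sup s t)"
    by (rule le_opp_iff[THEN iffD1])
qed (simp add: opp_antimono)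

lemma opp_inf: "opp (inf s t) = sup (opp s) (opp (t::'a::universe))"
  by (metis opp_opp opp_sup)

subsection \<open>Separability\<close>

text \<open>Take a maximal \<open>s \<in> [r, r']\<close> with \<open>sup s t \<in> S\<close> for all \<open>t \<ge> r\<close>. If \<open>inf s u \<notin> S\<close> for
  some \<open>u \<le> r'\<close>, choose \<open>u\<close> minimal; then \<open>sup s u\<close> is a larger such element.\<close>

lemma submodular_imp_separable:
  fixes S :: "'a::universe set"
  assumes "finite S" and sep: "separation_system S" and sub: "submodular S"
    and "r \<in> S" "r' \<in> S" "r \<le> r'"
  obtains s where "s \<in> S" "r \<le> s" "s \<le> r'" "emulates S s r" "emulates S (opp s) (opp r')"
proof -
  let ?E = "{s \<in> S. r \<le> s \<and> s \<le> r' \<and> (\<forall>t\<in>S. r \<le> t \<longrightarrow> sup s t \<in> S)}"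
  have "r \<in> ?E"
    using assms by (auto simp: sup.absorb2)
  then obtain s where s: "s \<in> ?E" and max: "\<And>s'. s' \<in> ?E \<Longrightarrow> s \<le> s' \<Longrightarrow> s = s'"
    using \<open>finite S\<close> finite_has_maximal[of ?E] by auto
  have meet: "inf s u \<in> S" if "u \<in> S" "u \<le> r'" for u
  proof (rule ccontr)
    let ?B = "{u \<in> S. u \<le> r' \<and> inf s u \<notin> S}"
    assume "inf s u \<notin> S"
    then have "?B \<noteq> {}"
      using that by auto
    then obtain v where v: "v \<in> ?B" and min: "\<And>v'. v' \<in> ?B \<Longrightarrow> v' \<le> v \<Longrightarrow> v = v'"
      using \<open>finite S\<close> finite_has_minimal[of ?B] by auto
    have "sup s v \<in> S"
      using v s sub by (auto simp: submodular_def)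
    \<comment> \<open>Let \<open>?w = sup s t\<close>. If its join with \<open>v\<close> left
      \<open>S\<close>, submodularity would put \<open>inf v ?w\<close> in \<open>S\<close>. As
      \<open>s \<le> ?w\<close>, this has the same meet with \<open>s\<close> as \<open>v\<close>,
      so minimality gives \<open>v \<le> ?w\<close> and the join is \<open>?w\<close>
      itself.\<close>
    moreover have "sup (sup s v) t \<in> S" if "t \<in> S" "r \<le> t" for t
    proof (rule ccontr)
      let ?w = "sup s t"
      assume "sup (sup s v) t \<notin> S"
      then have notin: "sup v ?w \<notin> S"
        by (simp add: sup_commute sup_left_commute)
      have "?w \<in> S"
        using s that by auto
      then have "inf v ?w \<in> S"
        using notin v sub by (auto simp: submodular_def)
      moreover have "inf s (inf v ?w) = inf s v"
        by (metis inf.left_commute inf_sup_absorb inf_commute)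
      ultimately have "inf v ?w \<in> ?B"
        using v by (auto intro: le_infI1)
      then have "v = inf v ?w"
        using min by auto
      then have "v \<le> ?w"
        by (metis inf_le2)
      then show False
        using notin \<open>?w \<in> S\<close> by (simp add: sup.absorb2)
    qed
    ultimately have "sup s v \<in> ?E"
      using s v by (auto intro: le_supI1)
    then have "s = sup s v"
      using max by auto
    then have "inf s v = v"
      by (metis inf.absorb2 sup.cobounded2)
    then show False
      using v by auto
  qed
  \<comment> \<open>De Morgan dual of the closure under meets just shown.\<close>
  have "sup (opp s) t \<in> S" if "t \<in> S" "opp r' \<le> t" for t
  proof -
    have "inf s (opp t) \<in> S"
      using that sep by (intro meet) (auto simp: separation_system_def opp_le_swap)
    then have "opp (inf s (opp t)) \<in> S"
      using sep by (auto simp: separation_system_def)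
    then show ?thesis
      by (simp add: opp_inf opp_opp)
  qed
  then have "emulates S (opp s) (opp r')"
    using s sep by (auto simp: emulates_def separation_system_def opp_le_iff)
  moreover have "emulates S s r"
    using s by (auto simp: emulates_def)
  ultimately show thesis
    using s that by auto
qed

subsection \<open>Unit propagation\<close>

text \<open>A star \<open>\<sigma>\<close> forbids choosing all its elements, so it is a clause with the literals \<open>opp x\<close> for
  \<open>x \<in> \<sigma>\<close>. A derivation of \<open>x\<close> is a tree over \<open>F\<close> and the singletons \<open>{opp p}\<close> with \<open>p \<in> P\<close>,
  hanging at a half-edge labelled \<open>x\<close> that points away from the tree.\<close>

inductive derivable :: "'a::universe set \<Rightarrow> 'a set set \<Rightarrow> 'a set \<Rightarrow> 'a \<Rightarrow> bool"
  for S F P where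
  unit: "x \<in> P \<Longrightarrow> derivable S F P x"
| star: "\<sigma> \<in> F \<Longrightarrow> \<sigma> \<subseteq> S \<Longrightarrow> opp x \<in> \<sigma> \<Longrightarrow> (\<And>y. y \<in> \<sigma> - {opp x} \<Longrightarrow> derivable S F P y)
    \<Longrightarrow> derivable S F P x"

lemma derivable_cut:
  assumes "derivable S F P x" "\<And>p. p \<in> P \<Longrightarrow> derivable S F P' p"
  shows "derivable S F P' x"
  using assms(1) by induction (auto intro: assms(2) derivable.star)

lemma derivable_mono: "derivable S F P x \<Longrightarrow> P \<subseteq> P' \<Longrightarrow> derivable S F P' x"
  by (erule derivable_cut) (auto intro: derivable.unit)

definition contradictory :: "'a::universe set \<Rightarrow> 'a set set \<Rightarrow> 'a set \<Rightarrow> bool" where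
  "contradictory S F P \<longleftrightarrow> (\<exists>x. derivable S F P x \<and> derivable S F P (opp x))"

locale shifting_closed_stars =
  fixes S :: "'a::universe set" and F :: "'a set set"
  assumes finite: "finite S"
    and sep_sys: "separation_system S"
    and submod: "submodular S"
    and stars: "\<And>\<sigma>. \<sigma> \<in> F \<Longrightarrow> star \<sigma>"
    and standard: "standard S F"
    and shifting: "closed_under_shifting S F"
begin

lemma opp_in: "s \<in> S \<Longrightarrow> opp s \<in> S"
  using sep_sys by (auto simp: separation_system_def)

lemma opp_in_iff: "opp s \<in> S \<longleftrightarrow> s \<in> S"
  using opp_in[of s] opp_in[of "opp s"] by (auto simp: opp_opp)

lemma derivable_in: "derivable S F P x \<Longrightarrow> P \<subseteq> S \<Longrightarrow> x \<in> S"
  by (induction rule: derivable.induct) (use opp_in_iff in blast)+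

lemma derivable_singleton:
  assumes "{opp x} \<in> F" "x \<in> S"
  shows "derivable S F P x"
  by (rule derivable.star[OF assms(1)]) (use assms opp_in in auto)

lemma derivable_trivial: "trivial_in S x \<Longrightarrow> derivable S F P x"
  using standard by (auto intro!: derivable_singleton simp: standard_def trivial_in_def)

lemma star_le_opp: "\<sigma> \<in> F \<Longrightarrow> x \<in> \<sigma> \<Longrightarrow> y \<in> \<sigma> \<Longrightarrow> x \<noteq> y \<Longrightarrow> x \<le> opp y"
  using stars by (auto simp: star_def)

section \<open>Shifting derivations\<close>

text \<open>Separations below a unit have to be derivable but need not be units, so a single
  \<open>u\<close> can be added once everything strictly below it is derivable. Shifting uses this
  at the leaves, where a unit \<open>p\<close> becomes \<open>inf p (opp s)\<close>.\<close>

definition down_derivable :: "'a set \<Rightarrow> bool" where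
  "down_derivable P \<longleftrightarrow> P \<subseteq> S \<and> (\<forall>x\<in>P. \<forall>y\<in>S. y \<le> x \<longrightarrow> derivable S F P y)"

text \<open>Replace each label \<open>y\<close> of the derivation by \<open>inf y (opp s)\<close>.
  Labels decrease towards the leaves, so all stay below \<open>opp r\<close>, and emulation keeps
  the shifted stars in \<open>F\<close>.\<close>

lemma derivable_shift:
  assumes P: "down_derivable P"
    and r: "\<not> derivable S F P r" and em: "emulates_for S F s r"
    and x: "derivable S F P x" "x \<le> opp r"
  shows "derivable S F P (inf x (opp s))"
proof -
  have PS: "P \<subseteq> S"
    using P by (simp add: down_derivable_def)
  have sup_in: "sup t s \<in> S" if "t \<in> S" "r \<le> t" "t \<noteq> opp r" for t
    using that em by (auto simp: emulates_for_def emulates_def sup_commute)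
  have inf_in: "inf y (opp s) \<in> S" if "derivable S F P y" "y \<le> opp r" for y
  proof -
    have "sup (opp y) s \<in> S"
    proof (rule sup_in)
      show "opp y \<in> S"
        using that derivable_in PS opp_in by blast
      show "r \<le> opp y"
        using that by (simp add: le_opp_iff)
      show "opp y \<noteq> opp r"
        using that r by (auto simp: opp_eq_iff)
    qed
    then show ?thesis
      using opp_in[of "sup (opp y) s"] by (simp add: opp_sup opp_opp)
  qed
  from x show ?thesis
  proof induction
    case (unit x)
    then show ?case
      using P inf_in[of x] by (auto simp: down_derivable_def derivable.unit)
  next
    case (star \<sigma> x)
    have le: "y \<le> x" if "y \<in> \<sigma> - {opp x}" for y
      using star_le_opp[OF star.hyps(1), of y "opp x"] star.hyps(3) that by (auto simp: opp_opp)
    have x: "derivable S F P x"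
      using star.hyps by (rule derivable.star) auto
    show ?case
    proof (cases "opp r \<in> \<sigma>")
      case True
      \<comment> \<open>Emulation says nothing about stars containing \<open>opp r\<close>. Here
        \<open>opp r\<close> is a premise and \<open>opp r \<le> x \<le> opp r\<close>, so premise
        and conclusion coincide and the induction hypothesis suffices.\<close>
      have "x \<noteq> r"
        using r x by auto
      then have *: "opp r \<in> \<sigma> - {opp x}"
        using True by (auto simp: opp_eq_iff)
      then have "x = opp r"
        using le star.prems by (auto intro: antisym)
      then show ?thesis
        using star.IH[OF *] by auto
    next
      case False
      let ?\<tau> = "shift \<sigma> (opp x) s"
      have "r \<le> opp x"
        using star.prems by (simp add: le_opp_iff)
      then have "?\<tau> \<in> F"
        using em star.hyps(1-3) False stars by (auto simp: emulates_for_def)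
      moreover have "?\<tau> \<subseteq> S"
      proof -
        have "sup (opp x) s \<in> S"
          using star.hyps(2,3) \<open>r \<le> opp x\<close> False by (intro sup_in) auto
        moreover have "inf y (opp s) \<in> S" if "y \<in> \<sigma> - {opp x}" for y
          using inf_in star.hyps(4) that le star.prems by (meson order_trans)
        ultimately show ?thesis
          by (auto simp: shift_def)
      qed
      moreover have "opp (inf x (opp s)) \<in> ?\<tau>"
        by (simp add: shift_def opp_inf opp_opp)
      ultimately show ?thesis
      proof (rule derivable.star)
        fix z assume "z \<in> ?\<tau> - {opp (inf x (opp s))}"
        then obtain y where "y \<in> \<sigma> - {opp x}" "z = inf y (opp s)"
          by (auto simp: shift_def opp_inf opp_opp)
        then show "derivable S F P z"
          using star.IH le star.prems by (meson order_trans)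
      qed
    qed
  qed
qed

text \<open>If \<open>r\<close> is needed to derive \<open>z\<close>, then reversing the path from the leaf \<open>r\<close> to the root derives
  \<open>opp r\<close> from \<open>opp z\<close>. There is only one such path: two leaves \<open>r\<close> would make \<open>r\<close> trivial.\<close>

lemma derivable_insert_cases:
  assumes "derivable S F (insert r P) z" and P: "insert r P \<subseteq> S" and r: "\<not> trivial_in S r"
    and "\<not> derivable S F P (opp r)" "r \<noteq> opp r"
  shows "derivable S F P z \<or>
    r \<le> z \<and> z \<noteq> opp r \<and> derivable S F (insert (opp z) P) (opp r)"
  using assms(1)
proof induction
  case (unit x)
  then show ?case
    using assms by (auto intro: derivable.unit)
next
  case (star \<sigma> x)
  have x: "x \<in> S"
    using star.hyps(2,3) opp_in_iff by auto
  have nontriv: "r = y \<or> r = opp y" if "y \<in> S" "r \<le> y" "r \<le> opp y" for y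
    using r P that by (auto simp: trivial_in_def less_le)
  let ?bad = "\<lambda>y. y \<in> \<sigma> - {opp x} \<and> \<not> derivable S F P y"
  have bad: "r \<le> y" "y \<noteq> opp r" "derivable S F (insert (opp y) P) (opp r)" if "?bad y" for y
    using star.IH that by blast+
  have le: "y \<le> x" if "y \<in> \<sigma> - {opp x}" for y
    using star_le_opp[OF star.hyps(1), of y "opp x"] star.hyps(3) that by (auto simp: opp_opp)
  show ?case
  proof (cases "\<exists>y. ?bad y")
    case False
    then show ?thesis
      using star.hyps by (blast intro: derivable.star)
  next
    case True
    then obtain y where y: "?bad y"
      by blast
    have uniq: "y' = y" if "?bad y'" for y'
    proof (rule ccontr)
      assume ne: "y' \<noteq> y"
      then have "y \<le> opp y'" "y' \<le> opp y"
        using star_le_opp[OF star.hyps(1)] y that by auto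
      then have "r \<le> opp y'" "r \<le> opp y"
        using bad(1) y that by (meson order_trans)+
      then have "r = y \<or> r = opp y" "r = y' \<or> r = opp y'"
        using nontriv bad(1) y that star.hyps(2) by auto
      then show False
        using ne bad(2) y that by (metis opp_opp)
    qed
    have "r \<le> x"
      using bad(1) le y by (meson order_trans)
    \<comment> \<open>Otherwise \<open>r\<close> lies below both \<open>y\<close> and
      \<open>opp y\<close>; nontriviality leaves only \<open>y = r = opp x\<close> or
      \<open>y = opp r\<close>, both excluded.\<close>
    moreover have "x \<noteq> opp r"
    proof
      assume "x = opp r"
      then have "r \<le> opp y"
        using le[of y] y le_opp_iff by blast
      then have "r = y \<or> r = opp y"
        using nontriv bad(1) y star.hyps(2) by auto
      then show False
        using y bad(2)[OF y] \<open>x = opp r\<close> by (auto simp: opp_opp)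
    qed
    moreover have "derivable S F (insert (opp x) P) (opp r)"
    proof (rule derivable_cut[OF bad(3)[OF y]])
      fix p assume "p \<in> insert (opp y) P"
      then show "derivable S F (insert (opp x) P) p"
      proof
        assume p: "p = opp y"
        show ?thesis
          unfolding p
        \<comment> \<open>The same star, now read with conclusion \<open>opp y\<close>: its other
          elements are \<open>opp x\<close>, which is a unit here, and premises that by uniqueness
          do not need \<open>r\<close>.\<close>
        proof (rule derivable.star[OF star.hyps(1,2)])
          show "opp (opp y) \<in> \<sigma>"
            using y by (simp add: opp_opp)
          fix w assume w: "w \<in> \<sigma> - {opp (opp y)}"
          show "derivable S F (insert (opp x) P) w"
          proof (cases "w = opp x")
            case True
            then show ?thesis
              by (auto intro: derivable.unit)
          next
            case False
            then have "derivable S F P w"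
              using uniq[of w] w by (auto simp: opp_opp)
            then show ?thesis
              by (rule derivable_mono) auto
          qed
        qed
      qed (auto intro: derivable.unit)
    qed
    ultimately show ?thesis
      by blast
  qed
qed

text \<open>If both \<open>z\<close> and \<open>opp z\<close> needed \<open>r\<close>, then
  \<open>r\<close> would lie strictly below both and be trivial. So one of them is derivable from
  \<open>P\<close> alone, and reversing the derivation of the other yields
  \<open>opp r\<close>.\<close>

lemma contradictory_insert:
  assumes P: "insert r P \<subseteq> S" and r: "\<not> trivial_in S r" "r \<noteq> opp r"
    and con: "contradictory S F (insert r P)" "\<not> contradictory S F P"
  shows "derivable S F P (opp r)"
proof (rule ccontr)
  assume not: "\<not> derivable S F P (opp r)"
  obtain z where z: "derivable S F (insert r P) z" "derivable S F (insert r P) (opp z)"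
    using con by (auto simp: contradictory_def)
  note cases = derivable_insert_cases[OF _ P r(1) not r(2)]
  have absurd: False if "derivable S F P w" "derivable S F (insert w P) (opp r)" for w
    using derivable_cut[OF that(2)] that(1) not by (auto intro: derivable.unit)
  consider "derivable S F P z" "derivable S F P (opp z)"
    | "derivable S F P z" "derivable S F (insert z P) (opp r)"
    | "derivable S F P (opp z)" "derivable S F (insert (opp z) P) (opp r)"
    | "r \<le> z" "z \<noteq> opp r" "r \<le> opp z" "opp z \<noteq> opp r"
    using cases[OF z(1)] cases[OF z(2)] by (auto simp: opp_opp)
  then show False
  proof cases
    case 1
    then show False
      using con by (auto simp: contradictory_def)
  next
    case 4
    have "z \<in> S"
      using derivable_in z(1) P by blast
    then show False
      using 4 r P by (auto simp: trivial_in_def less_le opp_opp opp_eq_iff)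
  qed (use absurd in blast)+
qed

text \<open>The derivable separations are consistent: for \<open>y \<le> x\<close>, shift \<open>opp y\<close> and \<open>x\<close> towards a
  separation between \<open>y\<close> and \<open>x\<close>.\<close>

lemma derivable_consistent:
  assumes P: "down_derivable P"
    and con: "\<not> contradictory S F P"
    and x: "derivable S F P x" and y: "y \<in> S" "y \<le> x"
  shows "\<not> derivable S F P (opp y)"
proof
  assume dy: "derivable S F P (opp y)"
  have xS: "x \<in> S"
    using derivable_in x P by (auto simp: down_derivable_def)
  obtain s where s: "s \<in> S" "y \<le> s" "s \<le> x" "emulates S s y" "emulates S (opp s) (opp x)"
    using submodular_imp_separable[OF finite sep_sys submod y(1) xS y(2)] by blast
  \<comment> \<open>If \<open>w\<close> were trivial or degenerate, or \<open>{opp w}\<close> were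
    in \<open>F\<close>, then \<open>w\<close> would be derivable along with \<open>opp w\<close>.
    Hence closure under shifting applies.\<close>
  have em: "emulates_for S F t w \<and> \<not> derivable S F P w"
    if "derivable S F P (opp w)" "w \<in> S" "emulates S t w" for t w
  proof -
    have w: "\<not> derivable S F P w"
      using that con by (auto simp: contradictory_def)
    then have "\<not> trivial_in S w" "{opp w} \<notin> F"
      using derivable_trivial derivable_singleton that(2) by blast+
    moreover have "\<not> degenerate w"
      using w that(1) by (auto simp: degenerate_def)
    moreover have "t \<in> S"
      using that(3) by (auto simp: emulates_def)
    ultimately show ?thesis
      using w that shifting by (auto simp: closed_under_shifting_def)
  qed
  have sy: "emulates_for S F s y" "\<not> derivable S F P y"
    using em[OF dy y(1) s(4)] by auto
  have sx: "emulates_for S F (opp s) (opp x)" "\<not> derivable S F P (opp x)"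
    using em[OF _ _ s(5)] x xS opp_in by (auto simp: opp_opp)
  have "derivable S F P (inf (opp y) (opp s))"
    using derivable_shift[OF P sy(2,1) dy] by auto
  moreover have "inf (opp y) (opp s) = opp s"
    using s(2) by (simp add: inf.absorb2 opp_antimono)
  moreover have "derivable S F P (inf x (opp (opp s)))"
    using derivable_shift[OF P sx(2,1) x] by (auto simp: opp_opp)
  moreover have "inf x (opp (opp s)) = s"
    using s(3) by (simp add: inf.absorb2 opp_opp)
  ultimately show False
    using con by (auto simp: contradictory_def)
qed

section \<open>From a maximal set of units to a tangle\<close>

lemma exists_complete:
  assumes "\<not> contradictory S F {}"
  obtains P where "down_derivable P" "\<not> contradictory S F P"
    "\<And>s. s \<in> S \<Longrightarrow> s \<noteq> opp s \<Longrightarrow> derivable S F P s \<or> derivable S F P (opp s)"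
proof -
  let ?I = "{P. down_derivable P \<and> \<not> contradictory S F P}"
  have "{} \<in> ?I"
    using assms by (auto simp: down_derivable_def)
  moreover have "finite ?I"
    by (rule finite_subset[of _ "Pow S"]) (auto simp: finite down_derivable_def)
  ultimately obtain P where PI: "P \<in> ?I" and "\<forall>P'\<in>?I. P \<subseteq> P' \<longrightarrow> P = P'"
    using finite_has_maximal[of ?I] by blast
  then have max: "P = P'" if "P' \<in> ?I" "P \<subseteq> P'" for P'
    using that by blast
  have P: "down_derivable P" and con: "\<not> contradictory S F P"
    using PI by auto
  have PS: "P \<subseteq> S"
    using P by (simp add: down_derivable_def)
  note consist = derivable_consistent[OF P con]
  let ?U = "{s \<in> S. s \<noteq> opp s \<and> \<not> derivable S F P s \<and> \<not> derivable S F P (opp s)}"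
  \<comment> \<open>Otherwise \<open>insert u P\<close> is down-derivable, so by maximality of
    \<open>P\<close> it is contradictory, and this refutes \<open>u\<close>.\<close>
  have below: "\<exists>y\<in>S. y < u \<and> \<not> derivable S F P y" if u: "u \<in> ?U" for u
  proof (rule ccontr)
    assume "\<not> ?thesis"
    then have *: "derivable S F P y" if "y \<in> S" "y < u" for y
      using that by blast
    have "derivable S F (insert u P) y" if "x \<in> insert u P" "y \<in> S" "y \<le> x" for x y
    proof (cases "y = u")
      case True
      then show ?thesis
        by (auto intro: derivable.unit)
    next
      case False
      then have "derivable S F P y"
        using that * P by (auto simp: down_derivable_def)
      then show ?thesis
        by (rule derivable_mono) auto
    qed
    moreover have "insert u P \<noteq> P"
      using u by (auto intro: derivable.unit)
    ultimately have "contradictory S F (insert u P)"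
      using max[of "insert u P"] u PS by (auto simp: down_derivable_def)
    moreover have "\<not> trivial_in S u"
      using derivable_trivial u by blast
    ultimately have "derivable S F P (opp u)"
      using contradictory_insert u PS con by auto
    then show False
      using u by auto
  qed
  have below': "\<exists>y\<in>S. y < u \<and> (y \<in> ?U \<or> derivable S F P (opp y))" if u: "u \<in> ?U" for u
  proof -
    obtain y where y: "y \<in> S" "y < u" "\<not> derivable S F P y"
      using below[OF u] by blast
    \<comment> \<open>A degenerate \<open>y\<close> below \<open>u\<close> has \<open>opp u\<close>
      below both its orientations, making \<open>opp u\<close> trivial and hence derivable.\<close>
    have "y \<noteq> opp y"
    proof
      assume eq: "y = opp y"
      have "opp u < opp y"
        using y(2) by (auto simp: less_le opp_le_iff opp_eq_iff)
      then have "trivial_in S (opp u)"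
        using u y(1) eq opp_in by (auto simp: trivial_in_def)
      then show False
        using u derivable_trivial by blast
    qed
    then show ?thesis
      using y by blast
  qed
  \<comment> \<open>Below a derivable \<open>x\<close>, consistency rules out that
    \<open>opp y\<close> is derivable, so from \<open>u\<close> in \<open>?B\<close> there is always
    a smaller element of \<open>?B\<close>.\<close>
  let ?B = "{u \<in> ?U. \<exists>x. derivable S F P x \<and> u \<le> x}"
  have B: "?B = {}"
  proof (rule ccontr)
    assume "?B \<noteq> {}"
    moreover have "finite ?B"
      using finite by auto
    ultimately obtain u where u: "u \<in> ?B" and min: "\<And>u'. u' \<in> ?B \<Longrightarrow> u' \<le> u \<Longrightarrow> u = u'"
      using finite_has_minimal[of ?B] by auto
    obtain x where x: "derivable S F P x" "u \<le> x"
      using u by blast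
    obtain y where y: "y \<in> S" "y < u" "y \<in> ?U \<or> derivable S F P (opp y)"
      using below' u by blast
    have "y \<le> x"
      using y(2) x(2) by auto
    then have "y \<in> ?U"
      using consist[OF x(1) y(1)] y(3) by blast
    then have "y \<in> ?B"
      using \<open>y \<le> x\<close> x(1) by blast
    then show False
      using min[of y] y(2) by (auto simp: less_le)
  qed
  \<comment> \<open>A minimal undecided \<open>u\<close> lies above some \<open>y\<close> with
    \<open>opp y\<close> derivable; then the undecided \<open>opp u\<close> lies below
    \<open>opp y\<close>, that is, in \<open>?B\<close>.\<close>
  have "?U = {}"
  proof (rule ccontr)
    assume "?U \<noteq> {}"
    moreover have "finite ?U"
      using finite by auto
    ultimately obtain u where u: "u \<in> ?U" and min: "\<And>u'. u' \<in> ?U \<Longrightarrow> u' \<le> u \<Longrightarrow> u = u'"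
      using finite_has_minimal[of ?U] by auto
    obtain y where y: "y \<in> S" "y < u" "y \<in> ?U \<or> derivable S F P (opp y)"
      using below' u by blast
    have "y \<notin> ?U"
      using min[OF _ less_imp_le[OF y(2)]] y(2) by blast
    then have "derivable S F P (opp y)"
      using y(3) by blast
    moreover have "opp u \<le> opp y"
      using y(2) by (simp add: opp_le_iff)
    moreover have "opp u \<in> ?U"
      using u opp_in by (auto simp: opp_opp)
    ultimately have "opp u \<in> ?B"
      by blast
    then show False
      using B by blast
  qed
  then have "derivable S F P s \<or> derivable S F P (opp s)" if "s \<in> S" "s \<noteq> opp s" for s
    using that by blast
  with P con show thesis
    by (rule that)
qed

text \<open>The derivable separations orient everything nondegenerate. Adding the degenerate ones
  completes the orientation and does no harm, as no star contains any.\<close>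

lemma exists_tangle:
  assumes con: "\<not> contradictory S F {}" and "{} \<notin> F"
  shows "\<exists>P. tangle S F P"
proof -
  obtain P where P: "down_derivable P"
    and con: "\<not> contradictory S F P"
    and complete: "\<And>s. s \<in> S \<Longrightarrow> s \<noteq> opp s \<Longrightarrow> derivable S F P s \<or> derivable S F P (opp s)"
    by (rule exists_complete[OF con]) (rule that)
  define Q where "Q = {s. derivable S F P s}"
  define D where "D = {s \<in> S. degenerate s}"
  have asym: "opp s \<notin> Q" if "s \<in> Q" for s
    using con that by (auto simp: Q_def contradictory_def)
  have QS: "Q \<subseteq> S"
    using derivable_in P by (auto simp: Q_def down_derivable_def)
  have triv: "s \<in> Q" if "trivial_in S s" for s
    using derivable_trivial that by (auto simp: Q_def)
  have "orientation S (Q \<union> D)"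
    unfolding orientation_def
  proof (intro conjI ballI)
    show "Q \<union> D \<subseteq> S"
      using QS by (auto simp: D_def)
    fix c assume "c \<in> sep ` S"
    then obtain s where s: "s \<in> S" "c = {s, opp s}"
      by (auto simp: sep_def)
    show "\<exists>!x. x \<in> c \<and> x \<in> Q \<union> D"
    proof (cases "s = opp s")
      case True
      then show ?thesis
        using s by (auto simp: D_def degenerate_def)
    next
      case False
      then have "s \<notin> D" "opp s \<notin> D"
        by (auto simp: D_def degenerate_def opp_opp)
      moreover have "s \<in> Q \<or> opp s \<in> Q"
        using complete[OF s(1) False] by (simp add: Q_def)
      ultimately show ?thesis
        using asym[of s] s(2) by auto
    qed
  qed
  moreover have "consistent S (Q \<union> D)"
    unfolding consistent_def
  proof (intro ballI impI notI)
    fix r s assume rs: "r \<in> S" "s \<in> S" "sep r \<noteq> sep s \<and> r \<le> s \<and> s \<in> Q \<union> D" "opp r \<in> Q \<union> D"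
    have "r < s"
      using rs(3) by auto
    then have "opp s < opp r"
      by (auto simp: less_le opp_le_iff opp_eq_iff)
    show False
    proof (cases "degenerate r")
      \<comment> \<open>Here \<open>opp s\<close> lies below both orientations of \<open>r\<close>,
        so it is trivial and derivable. This forces \<open>s\<close> to be degenerate, against
        \<open>opp s < r < s\<close>.\<close>
      case True
      then have "opp s < r"
        using \<open>opp s < opp r\<close> by (simp add: degenerate_def)
      then have "opp s \<in> Q"
        using triv rs \<open>opp s < opp r\<close> opp_in by (auto simp: trivial_in_def)
      then have "s \<in> D"
        using asym[of s] rs(3) by blast
      then show False
        using \<open>opp s < r\<close> \<open>r < s\<close> by (auto simp: D_def degenerate_def)
    next
      case False
      then have opp_r: "opp r \<in> Q"
        using rs(4) by (auto simp: D_def degenerate_def opp_opp)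
      show False
      proof (cases "s \<in> Q")
        case True
        then show False
          using derivable_consistent[OF P con] rs opp_r by (auto simp: Q_def)
      next
        case False
        then have "s = opp s"
          using rs(3) by (auto simp: D_def degenerate_def)
        then have "r \<in> Q"
          using triv[of r] rs(1,2) \<open>r < s\<close> unfolding trivial_in_def by metis
        then show False
          using asym opp_r by blast
      qed
    qed
  qed
  moreover have "\<sigma> \<notin> F" if "\<sigma> \<subseteq> Q \<union> D" for \<sigma>
  proof
    assume \<sigma>: "\<sigma> \<in> F"
    then have "\<sigma> \<subseteq> Q"
      using stars that by (auto simp: star_def D_def)
    moreover obtain x where "x \<in> \<sigma>"
      using \<sigma> \<open>{} \<notin> F\<close> by (metis ex_in_conv)
    \<comment> \<open>A star inside \<open>Q\<close> fires as a clause against any of its own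
      elements.\<close>
    ultimately have "opp x \<in> Q"
      using derivable.star[OF \<sigma>, of S "opp x" P] QS by (auto simp: Q_def opp_opp)
    then show False
      using asym \<open>\<sigma> \<subseteq> Q\<close> \<open>x \<in> \<sigma>\<close> by blast
  qed
  ultimately show ?thesis
    unfolding tangle_def by blast
qed

end

subsection \<open>Cycles and rooted trees\<close>

lemma cycle_map:
  fixes T :: "'v pair_pre_digraph"
  assumes wf: "pair_wf_digraph T" and arcs: "\<And>i. (c i, c (Suc i)) \<in> parcs T"
    and n: "0 < n" "c n = c 0" "inj_on c {..<n}"
  shows "pre_digraph.cycle (with_proj T) (map (\<lambda>i. (c i, c (Suc i))) [0..<n])"
proof -
  interpret pair_wf_digraph T by fact
  let ?p = "\<lambda>k. map (\<lambda>i. (c i, c (Suc i))) [k..<n]"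
  have *: "pcas (c k) (?p k) (c n) \<and> pawalk_verts (c k) (?p k) = map c [k..<Suc n]"
    if "k \<le> n" for k
    using that by (induction rule: inc_induct) (auto simp: upt_conv_Cons)
  \<comment> \<open>The vertices after the first are \<open>c 1\<close> to \<open>c n\<close>;
    injectivity carries over to them by taking indices modulo \<open>n\<close>, since
    \<open>c n = c 0\<close>.\<close>
  have "inj_on c {1..n}"
  proof (rule inj_onI)
    fix i j assume ij: "i \<in> {1..n}" "j \<in> {1..n}" "c i = c j"
    have "i mod n < n" "j mod n < n" "c (i mod n) = c i" "c (j mod n) = c j"
      using n ij(1,2) by (auto simp: le_less)
    then have "i mod n = j mod n"
      using inj_onD[OF n(3), of "i mod n" "j mod n"] ij(3) by auto
    then show "i = j"
      using ij(1,2) by (auto simp: le_less)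
  qed
  moreover have "{1..<Suc n} = {1..n}"
    by auto
  moreover have "tl (pawalk_verts (c 0) (?p 0)) = map c [1..<Suc n]"
    using *[of 0] by (simp add: map_tl[symmetric] tl_upt del: upt_Suc)
  ultimately have "distinct (tl (pawalk_verts (c 0) (?p 0)))"
    by (simp add: distinct_map del: upt_Suc)
  moreover have "awalk (c 0) (?p 0) (c 0)"
    using * [of 0] n(2) arcs in_arcsD1[OF arcs[of 0]] by (auto simp: awalk_def)
  ultimately show ?thesis
    using n(1) unfolding cycle_def by auto
qed

lemma pcas_nth:
  assumes "pcas u p v" "i < length p"
  shows "fst (p ! i) = (if i = 0 then u else snd (p ! (i - 1)))"
    and "snd (last p) = v"
  using assms by (induction u p v arbitrary: i rule: pcas.induct) (auto simp: nth_Cons' split: if_splits)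

text \<open>Reading a cycle as a periodic sequence gives every vertex a predecessor and a successor
  without boundary cases.\<close>

lemma cycleE:
  fixes T :: "'v pair_pre_digraph"
  assumes wf: "pair_wf_digraph T" and p: "pre_digraph.cycle (with_proj T) p"
  obtains c where "\<And>i. (c i, c (Suc i)) \<in> parcs T" "\<And>i. c (i + length p) = c i"
    "\<And>i j. c i = c j \<Longrightarrow> i mod length p = j mod length p"
proof -
  interpret pair_wf_digraph T by fact
  let ?n = "length p"
  obtain u where u: "u \<in> pverts T" "set p \<subseteq> parcs T" "pcas u p u" "p \<noteq> []"
      "distinct (tl (pawalk_verts u p))"
    using p by (auto simp: cycle_def awalk_def)
  have "pawalk_verts u p = fst (hd p) # map snd p"
    using awalk_verts_conv'[of u p u] u(3,4) by simp
  then have dist: "distinct (map snd p)"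
    using u(5) by simp
  let ?c = "\<lambda>i. snd (p ! (i mod ?n))"
  have "(?c i, ?c (Suc i)) = p ! (Suc i mod ?n)" for i
  proof (cases "Suc (i mod ?n) = ?n")
    case True
    then have "i mod ?n = ?n - 1" "Suc i mod ?n = 0"
      by (auto simp: mod_Suc)
    then show ?thesis
      using pcas_nth[OF u(3), of 0] u(4) last_conv_nth[of p] by (simp add: prod_eq_iff)
  next
    case False
    then have "Suc i mod ?n = Suc (i mod ?n)"
      by (simp add: mod_Suc)
    moreover from this have "Suc (i mod ?n) < ?n"
      using u(4) by (metis length_greater_0_conv mod_less_divisor)
    ultimately show ?thesis
      using pcas_nth(1)[OF u(3), of "Suc (i mod ?n)"] by (simp add: prod_eq_iff)
  qed
  moreover have "p ! (i mod ?n) \<in> parcs T" for i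
    using u(2,4) by (auto intro!: nth_mem)
  moreover have "i mod ?n = j mod ?n" if "?c i = ?c j" for i j
    using dist that u(4) nth_eq_iff_index_eq[of "map snd p" "i mod ?n" "j mod ?n"] by simp
  ultimately show thesis
    by (intro that[of ?c]) auto
qed

text \<open>On a cycle, both neighbours of a deepest vertex are its parent, so the vertices two
  steps apart around it agree. Then the length divides 2.\<close>

lemma finite_tree_parent:
  fixes par :: "'v \<Rightarrow> 'v" and d :: "'v \<Rightarrow> nat"
  assumes V: "finite V" "r \<in> V" and par: "\<And>v. v \<in> V - {r} \<Longrightarrow> par v \<in> V"
    and d: "\<And>v. v \<in> V - {r} \<Longrightarrow> d (par v) < d v"
  defines "E \<equiv> (\<lambda>v. (v, par v)) ` (V - {r})"
  shows "finite_tree \<lparr>pverts = V, parcs = E \<union> E\<inverse>\<rparr>"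
    (is "finite_tree ?T")
  unfolding finite_tree_def
proof (intro conjI notI)
  have "par v \<in> V" "par v \<noteq> v" if "v \<in> V" "v \<noteq> r" for v
    using that par[of v] d[of v] by auto
  then show "pair_graph ?T"
    using V by unfold_locales (force simp: E_def symmetric_def sym_def)+
  then interpret pair_graph ?T .
  have arc: "u = par v \<and> v \<in> V - {r} \<or> v = par u \<and> u \<in> V - {r}" if "(u, v) \<in> E \<union> E\<inverse>" for u v
    using that by (auto simp: E_def)
  show "connected (with_proj ?T)"
  proof -
    have *: "v \<rightarrow>\<^sup>*\<^bsub>with_proj ?T\<^esub> r \<and> r \<rightarrow>\<^sup>*\<^bsub>with_proj ?T\<^esub> v" if "v \<in> V" for v
      using that
    proof (induction "d v" arbitrary: v rule: less_induct)
      case less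
      show ?case
      proof (cases "v = r")
        case True
        then show ?thesis
          using V by auto
      next
        case False
        then have v: "v \<in> V - {r}"
          using less.prems by auto
        then have arcs: "(v, par v) \<in> parcs ?T" "(par v, v) \<in> parcs ?T"
          by (auto simp: E_def)
        note IH = less.hyps[OF d[OF v] par[OF v]]
        show ?thesis
          using adj_reachable_trans[OF arcs(1) IH[THEN conjunct1]]
            reachable_adj_trans[OF IH[THEN conjunct2] arcs(2)] by (rule conjI)
      qed
    qed
    have "strongly_connected (with_proj ?T)"
      using V * by (intro strongly_connectedI) (auto intro: reachable_trans)
    then show ?thesis
      unfolding connected_def strongly_connected_def
      using reachable_mk_symmetricI by (auto simp: mk_symmetric_def)
  qed
  assume "\<exists>p. cycle p \<and> 3 \<le> length p"
  then obtain p where p: "cycle p" "3 \<le> length p"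
    by blast
  let ?n = "length p"
  obtain c where c: "\<And>i. (c i, c (Suc i)) \<in> parcs ?T" "\<And>i. c (i + ?n) = c i"
    "\<And>i j. c i = c j \<Longrightarrow> i mod ?n = j mod ?n"
    by (rule cycleE[OF pair_wf_digraph p(1)]) (rule that)
  have "c i \<in> V" for i
    using in_arcsD1[OF c(1)[of i]] by simp
  then have "finite (range c)"
    by (intro finite_subset[OF _ V(1)]) auto
  then obtain j where j: "\<And>i. d (c i) \<le> d (c j)"
    using Max_ge[of "d ` range c"] Max_in[of "d ` range c"] by fastforce
  \<comment> \<open>The predecessor of \<open>j\<close>, moved up by one period to keep the index a
    natural number.\<close>
  define k where "k = j + ?n - 1"
  have "Suc k = j + ?n"
    using p(2) by (simp add: k_def)
  then have k: "c (Suc k) = c j"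
    using c(2)[of j] by simp
  have "c k = par (c (Suc k))"
    using arc[of "c k" "c (Suc k)"] c(1)[of k] d[of "c k"] j[of k] k by fastforce
  moreover have "c (Suc (Suc k)) = par (c (Suc k))"
    using arc[of "c (Suc k)" "c (Suc (Suc k))"] c(1)[of "Suc k"] d[of "c (Suc (Suc k))"]
      j[of "Suc (Suc k)"] k by fastforce
  ultimately have "Suc (Suc k) mod ?n = k mod ?n"
    using c(3)[of "Suc (Suc k)" k] by simp
  then have "?n dvd Suc (Suc k) - k"
    by (subst mod_eq_dvd_iff_nat[symmetric]) auto
  then show False
    using p(2) by (auto dest!: dvd_imp_le)
qed

text \<open>\<open>l v\<close> labels the arc from \<open>v\<close> to its parent. The arcs entering
  \<open>v\<close> thus carry the labels \<open>l u\<close> of the children \<open>u\<close> and,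
  unless \<open>v\<close> is the root, \<open>opp (l v)\<close> from the parent.\<close>

lemma S_tree_over_parent:
  fixes par :: "'v \<Rightarrow> 'v" and d :: "'v \<Rightarrow> nat" and l :: "'v \<Rightarrow> 'a::universe"
  assumes S: "separation_system S"
    and V: "finite V" "r \<in> V" and par: "\<And>v. v \<in> V - {r} \<Longrightarrow> par v \<in> V"
    and d: "\<And>v. v \<in> V - {r} \<Longrightarrow> d (par v) < d v"
    and l: "\<And>v. v \<in> V - {r} \<Longrightarrow> l v \<in> S"
    and F: "\<And>v. v \<in> V \<Longrightarrow> l ` {u \<in> V - {r}. par u = v} \<union> (if v = r then {} else {opp (l v)}) \<in> F"
  shows "\<exists>(T :: 'v pair_pre_digraph) \<alpha>. S_tree_over S F T \<alpha>"
proof (intro exI)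
  let ?E = "(\<lambda>v. (v, par v)) ` (V - {r})"
  let ?T = "\<lparr>pverts = V, parcs = ?E \<union> ?E\<inverse>\<rparr>"
  let ?\<alpha> = "\<lambda>(u, v). if u \<in> V - {r} \<and> v = par u then l u else opp (l v)"
  have up: "?\<alpha> (v, par v) = l v" if "v \<in> V - {r}" for v
    using that by auto
  \<comment> \<open>Depths exclude \<open>par (par v) = v\<close>, so a downward arc is never
    mistaken for an upward one.\<close>
  have down: "?\<alpha> (par v, v) = opp (l v)" if "v \<in> V - {r}" for v
    using that d[of v] d[of "par v"] by auto
  have "finite_tree ?T"
    by (rule finite_tree_parent[where d = d]) (use assms in auto)
  moreover have "?\<alpha> (x, y) \<in> S \<and> ?\<alpha> (y, x) = opp (?\<alpha> (x, y))" if xy: "(x, y) \<in> parcs ?T" for x y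
  proof -
    consider "x \<in> V - {r}" "y = par x" | "y \<in> V - {r}" "x = par y"
      using xy by force
    then show ?thesis
    proof cases
      case 1
      then show ?thesis
        using up[of x] down[of x] l[of x] by simp
    next
      case 2
      then show ?thesis
        using up[of y] down[of y] l[of y] S by (simp add: opp_opp separation_system_def)
    qed
  qed
  moreover have "?\<alpha> ` {(s, t) |s. (s, t) \<in> parcs ?T} \<in> F" if t: "t \<in> pverts ?T" for t
  proof -
    have "{(s, t) |s. (s, t) \<in> parcs ?T} =
        (\<lambda>u. (u, par u)) ` {u \<in> V - {r}. par u = t} \<union> (if t = r then {} else {(par t, t)})"
      using t by auto
    moreover have "?\<alpha> ` ((\<lambda>u. (u, par u)) ` {u \<in> V - {r}. par u = t}) = l ` {u \<in> V - {r}. par u = t}"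
      unfolding image_image by (intro image_cong refl up) auto
    moreover have "?\<alpha> ` (if t = r then {} else {(par t, t)}) = (if t = r then {} else {opp (l t)})"
      using down[of t] t by auto
    ultimately show ?thesis
      using F[of t] t by (simp only: image_Un) simp
  qed
  ultimately show "S_tree_over S F ?T ?\<alpha>"
    unfolding S_tree_over_def S_tree_def by blast
qed

text \<open>Renames the nodes, so that trees built on lists become trees on natural numbers.\<close>

lemma S_tree_over_parent_nat:
  fixes par :: "'v \<Rightarrow> 'v" and d :: "'v \<Rightarrow> nat" and l :: "'v \<Rightarrow> 'a::universe"
  assumes S: "separation_system S"
    and V: "finite V" "r \<in> V" and par: "\<And>v. v \<in> V - {r} \<Longrightarrow> par v \<in> V"
    and d: "\<And>v. v \<in> V - {r} \<Longrightarrow> d (par v) < d v"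
    and l: "\<And>v. v \<in> V - {r} \<Longrightarrow> l v \<in> S"
    and F: "\<And>v. v \<in> V \<Longrightarrow> l ` {u \<in> V - {r}. par u = v} \<union> (if v = r then {} else {opp (l v)}) \<in> F"
  shows "\<exists>(T :: nat pair_pre_digraph) \<alpha>. S_tree_over S F T \<alpha>"
proof -
  obtain f :: "'v \<Rightarrow> nat" where f: "inj_on f V"
    using finite_imp_inj_to_nat_seg[OF V(1)] by blast
  define g where "g = inv_into V f"
  have g: "g (f v) = v" if "v \<in> V" for v
    using that f by (simp add: g_def)
  have feq: "f u = f v \<longleftrightarrow> u = v" if "u \<in> V" "v \<in> V" for u v
    using that f by (auto dest: inj_onD)
  show ?thesis
  proof (rule S_tree_over_parent[where V = "f ` V" and r = "f r" and par = "f \<circ> par \<circ> g"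
        and d = "d \<circ> g" and l = "l \<circ> g"])
    show "(l \<circ> g) ` {u \<in> f ` V - {f r}. (f \<circ> par \<circ> g) u = v} \<union>
        (if v = f r then {} else {opp ((l \<circ> g) v)}) \<in> F" if v: "v \<in> f ` V" for v
    proof -
      obtain w where w: "w \<in> V" "v = f w"
        using v by blast
      have "{u \<in> f ` V - {f r}. (f \<circ> par \<circ> g) u = v} = f ` {u \<in> V - {r}. par u = w}"
        using w g feq par V(2) by auto
      moreover have "(l \<circ> g) ` f ` {u \<in> V - {r}. par u = w} = l ` {u \<in> V - {r}. par u = w}"
        unfolding image_image by (intro image_cong refl) (simp add: g)
      ultimately show ?thesis
        using F[OF w(1)] w g feq[OF w(1) V(2)] by (cases "w = r") (simp_all del: image_comp)
    qed
  qed (use S V par d l g feq in auto)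
qed

subsection \<open>Trees from derivations\<close>

text \<open>Nodes of the tree unfolding of \<open>K\<close> from the root set \<open>R\<close>. A
  label may occur at several places, so a node records its whole branch, newest label first:
  \<open>hd\<close> is its label and \<open>tl\<close> its parent.\<close>

inductive_set paths :: "'a set \<Rightarrow> ('a \<Rightarrow> 'a set) \<Rightarrow> 'a list set" for R K where
  Nil: "[] \<in> paths R K"
| single: "y \<in> R \<Longrightarrow> [y] \<in> paths R K"
| Cons: "x # w \<in> paths R K \<Longrightarrow> y \<in> K x \<Longrightarrow> y # x # w \<in> paths R K"

inductive_simps paths_single: "[y] \<in> paths R K"
inductive_simps paths_Cons: "y # x # w \<in> paths R K"

lemma paths_tl: "w \<in> paths R K \<Longrightarrow> tl w \<in> paths R K"
  by (induction rule: paths.induct) (auto intro: paths.intros)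

lemma paths_subset:
  assumes "w \<in> paths R K" "R \<subseteq> A" "\<And>x. x \<in> A \<Longrightarrow> K x \<subseteq> A"
  shows "set w \<subseteq> A"
  using assms by (induction rule: paths.induct) auto

lemma finite_paths:
  fixes \<rho> :: "'a \<Rightarrow> nat"
  assumes "finite A" "R \<subseteq> A" "\<And>x. x \<in> A \<Longrightarrow> K x \<subseteq> A"
    and "\<And>x y. x \<in> A \<Longrightarrow> y \<in> K x \<Longrightarrow> \<rho> y < \<rho> x"
  shows "finite (paths R K)"
proof -
  let ?M = "Max (\<rho> ` A)"
  \<comment> \<open>Each extension lengthens the path by one and lowers the rank of its head by at
    least one.\<close>
  have "length w \<le> Suc ?M \<and> (w \<noteq> [] \<longrightarrow> length w + \<rho> (hd w) \<le> Suc ?M)"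
    if "w \<in> paths R K" for w
    using that
  proof induction
    case (single y)
    then have "y \<in> A"
      using assms(2) by blast
    then show ?case
      using assms(1) by simp
  next
    case (Cons x w y)
    have "x \<in> A"
      using paths_subset[OF Cons.hyps(1) assms(2,3)] by auto
    then show ?case
      using Cons assms(4) by fastforce
  qed auto
  moreover have "set w \<subseteq> A" if "w \<in> paths R K" for w
    using paths_subset[OF that assms(2,3)] .
  ultimately have "paths R K \<subseteq> {w. set w \<subseteq> A \<and> length w \<le> Suc ?M}"
    by blast
  then show ?thesis
    using finite_lists_length_le[OF assms(1)] finite_subset by blast
qed

text \<open>\<open>L n\<close> holds what trees of height at most \<open>n\<close> derive. The rank
  is the first such \<open>n\<close>, and \<open>K x\<close> is a star deriving \<open>x\<close>
  from smaller ranks, so following \<open>K\<close> terminates.\<close>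

lemma derivable_rank:
  fixes S :: "'a::universe set"
  assumes "finite S"
  obtains \<rho> :: "'a \<Rightarrow> nat" and K where
    "\<And>x. derivable S F {} x \<Longrightarrow> K x \<in> F \<and> K x \<subseteq> S \<and> opp x \<in> K x"
    "\<And>x y. derivable S F {} x \<Longrightarrow> y \<in> K x - {opp x} \<Longrightarrow> derivable S F {} y \<and> \<rho> y < \<rho> x"
proof -
  define L where "L = rec_nat {} (\<lambda>_ A. {x. \<exists>\<sigma>\<in>F. \<sigma> \<subseteq> S \<and> opp x \<in> \<sigma> \<and> \<sigma> - {opp x} \<subseteq> A})"
  have L0: "L 0 = {}" and LSuc: "L (Suc n) = {x. \<exists>\<sigma>\<in>F. \<sigma> \<subseteq> S \<and> opp x \<in> \<sigma> \<and> \<sigma> - {opp x} \<subseteq> L n}" for n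
    by (simp_all add: L_def)
  have "L n \<subseteq> L (Suc n)" for n
  proof (induction n)
    case (Suc n)
    then show ?case
      unfolding LSuc[of "Suc n"] LSuc[of n] by blast
  qed (simp add: L0)
  then have mono: "L m \<subseteq> L n" if "m \<le> n" for m n
    using that by (rule lift_Suc_mono_le)
  have sound: "derivable S F {} x" if "x \<in> L n" for x n
    using that
  proof (induction n arbitrary: x)
    case (Suc n)
    from Suc.prems obtain \<sigma> where \<sigma>: "\<sigma> \<in> F" "\<sigma> \<subseteq> S" "opp x \<in> \<sigma>" "\<sigma> - {opp x} \<subseteq> L n"
      unfolding LSuc by blast
    show ?case
      by (rule derivable.star[OF \<sigma>(1-3)]) (use Suc.IH \<sigma>(4) in blast)
  qed (simp add: L0)
  have complete: "\<exists>n. x \<in> L n" if "derivable S F {} x" for x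
    using that
  proof induction
    case (star \<sigma> x)
    then obtain h where h: "\<And>y. y \<in> \<sigma> - {opp x} \<Longrightarrow> y \<in> L (h y)"
      by metis
    have "finite (\<sigma> - {opp x})"
      using star.hyps(2) assms finite_subset by blast
    \<comment> \<open>For \<open>\<sigma> = {opp x}\<close> the \<open>Max\<close> is taken over the
      empty set; its value is harmless, as the inclusion is then vacuous.\<close>
    then have "\<sigma> - {opp x} \<subseteq> L (Max (h ` (\<sigma> - {opp x})))"
      using h mono[OF Max_ge[of "h ` (\<sigma> - {opp x})"]] by blast
    then have "x \<in> L (Suc (Max (h ` (\<sigma> - {opp x}))))"
      using star.hyps(1-3) unfolding LSuc by blast
    then show ?case ..
  qed simp
  define \<rho> where "\<rho> x = (LEAST n. x \<in> L n)" for x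
  have "\<exists>\<sigma>. \<sigma> \<in> F \<and> \<sigma> \<subseteq> S \<and> opp x \<in> \<sigma> \<and> (\<forall>y\<in>\<sigma> - {opp x}. derivable S F {} y \<and> \<rho> y < \<rho> x)"
    if x: "derivable S F {} x" for x
  proof -
    have "x \<in> L (\<rho> x)"
      unfolding \<rho>_def using complete[OF x] by (rule LeastI_ex)
    moreover from this obtain k where k: "\<rho> x = Suc k"
      by (cases "\<rho> x") (auto simp: L0)
    ultimately obtain \<sigma> where \<sigma>: "\<sigma> \<in> F" "\<sigma> \<subseteq> S" "opp x \<in> \<sigma>" "\<sigma> - {opp x} \<subseteq> L k"
      unfolding k LSuc by blast
    have "derivable S F {} y \<and> \<rho> y < \<rho> x" if "y \<in> \<sigma> - {opp x}" for y
    proof -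
      have y: "y \<in> L k"
        using \<sigma>(4) that by blast
      then have "\<rho> y \<le> k"
        unfolding \<rho>_def by (rule Least_le)
      then show ?thesis
        using sound[OF y] k by simp
    qed
    then show ?thesis
      using \<sigma> by blast
  qed
  then obtain K where "\<And>x. derivable S F {} x \<Longrightarrow> K x \<in> F \<and> K x \<subseteq> S \<and> opp x \<in> K x \<and>
      (\<forall>y\<in>K x - {opp x}. derivable S F {} y \<and> \<rho> y < \<rho> x)"
    by metis
  then show thesis
    using that[of K \<rho>] by blast
qed

context shifting_closed_stars
begin

text \<open>The root \<open>[]\<close> gets the star \<sigma>. Any other node \<open>w\<close> gets
  \<open>K (hd w)\<close>, whose element \<open>opp (hd w)\<close> labels the arc from the parent
  and whose other elements label the arcs from the children.\<close>

lemma exists_S_tree: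
  assumes \<sigma>: "\<sigma> \<in> F" "\<And>x. x \<in> \<sigma> \<Longrightarrow> derivable S F {} x"
  shows "\<exists>(T :: nat pair_pre_digraph) \<alpha>. S_tree_over S F T \<alpha>"
proof -
  obtain \<rho> :: "'a \<Rightarrow> nat" and K where
    K: "\<And>x. derivable S F {} x \<Longrightarrow> K x \<in> F \<and> K x \<subseteq> S \<and> opp x \<in> K x"
    and \<rho>: "\<And>x y. derivable S F {} x \<Longrightarrow> y \<in> K x - {opp x} \<Longrightarrow> derivable S F {} y \<and> \<rho> y < \<rho> x"
    by (rule derivable_rank[OF finite, of F]) (rule that)
  let ?A = "{x. derivable S F {} x}"
  let ?K = "\<lambda>x. K x - {opp x}"
  let ?V = "paths \<sigma> ?K"
  have A: "finite ?A" "?A \<subseteq> S"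
    using derivable_in finite by (auto intro: finite_subset)
  have closed: "\<sigma> \<subseteq> ?A" "\<And>x. x \<in> ?A \<Longrightarrow> ?K x \<subseteq> ?A"
    using \<sigma>(2) \<rho> by blast+
  have V: "set w \<subseteq> ?A" if "w \<in> ?V" for w
    using paths_subset[OF that closed] .
  show ?thesis
  proof (rule S_tree_over_parent_nat[where V = ?V and r = "[]" and par = tl and l = hd and d = length])
    show "finite ?V"
      by (rule finite_paths[OF A(1) closed, where \<rho> = \<rho>]) (use \<rho> in auto)
    show "hd w \<in> S" if "w \<in> ?V - {[]}" for w
      using that V[of w] A(2) hd_in_set[of w] by blast
    show "hd ` {u \<in> ?V - {[]}. tl u = w} \<union> (if w = [] then {} else {opp (hd w)}) \<in> F"
      if w: "w \<in> ?V" for w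
    proof -
      have "hd ` {u \<in> ?V - {[]}. tl u = w} = {y. y # w \<in> ?V}"
        by (force simp: neq_Nil_conv)
      moreover have "{y. y # w \<in> ?V} = (if w = [] then \<sigma> else ?K (hd w))"
        using w by (cases w) (auto simp: paths_single paths_Cons)
      moreover have "derivable S F {} (hd w)" if "w \<noteq> []"
        using V[OF w] hd_in_set[OF that] by blast
      ultimately show ?thesis
        using \<sigma>(1) K[of "hd w"] by (cases "w = []") (simp_all add: insert_absorb)
    qed
  qed (auto simp: sep_sys intro: paths.Nil paths_tl)
qed

text \<open>The last star in a derivation of \<open>x\<close> consists of derivable premises and
  \<open>opp x\<close>, which is derivable too; it can serve as the root star.\<close>

lemma exists_S_tree_if_contradictory:
  assumes "contradictory S F {}"
  shows "\<exists>(T :: nat pair_pre_digraph) \<alpha>. S_tree_over S F T \<alpha>"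
proof -
  obtain x where "derivable S F {} x" "derivable S F {} (opp x)"
    using assms by (auto simp: contradictory_def)
  then obtain \<sigma> where "\<sigma> \<in> F" "\<And>y. y \<in> \<sigma> \<Longrightarrow> derivable S F {} y"
    by (cases rule: derivable.cases) auto
  then show ?thesis
    by (rule exists_S_tree)
qed

end

subsection \<open>Duality\<close>

text \<open>No node has all its incoming labels in \<open>P\<close>, so each has an arc leading out
  in the direction chosen by \<open>P\<close>. Following such arcs closes a cycle.\<close>

lemma no_tangle_if_S_tree:
  assumes T: "S_tree_over S F T \<alpha>" and P: "tangle S F P"
  shows False
proof -
  have tree: "finite_tree T"
    and arcs: "\<forall>(x, y) \<in> parcs T. \<alpha> (x, y) \<in> S \<and> \<alpha> (y, x) = opp (\<alpha> (x, y))"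
    and F: "\<forall>t \<in> pverts T. \<alpha> ` {(s, t) |s. (s, t) \<in> parcs T} \<in> F"
    using T unfolding S_tree_over_def S_tree_def by iprover+
  have "pair_graph T" and conn: "connected (with_proj T)"
    and acyclic: "\<not> (\<exists>p. pre_digraph.cycle (with_proj T) p \<and> 3 \<le> length p)"
    using tree unfolding finite_tree_def by iprover+
  have \<alpha>: "\<alpha> (x, y) \<in> S \<and> \<alpha> (y, x) = opp (\<alpha> (x, y))" if "(x, y) \<in> parcs T" for x y
    using bspec[OF arcs that] by simp
  interpret pair_graph T by fact
  have "\<exists>s. (t, s) \<in> parcs T \<and> \<alpha> (t, s) \<in> P \<and> \<alpha> (s, t) \<notin> P" if "t \<in> pverts T" for t
  proof -
    have "\<not> \<alpha> ` {(s, t) |s. (s, t) \<in> parcs T} \<subseteq> P"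
    proof
      assume "\<alpha> ` {(s, t) |s. (s, t) \<in> parcs T} \<subseteq> P"
      then have "\<alpha> ` {(s, t) |s. (s, t) \<in> parcs T} \<notin> F"
        using P by (simp add: tangle_def)
      then show False
        using bspec[OF F that] by contradiction
    qed
    then obtain s where s: "(s, t) \<in> parcs T" "\<alpha> (s, t) \<notin> P"
      by blast
    have "\<alpha> (t, s) = opp (\<alpha> (s, t))"
      by (rule conjunct2[OF \<alpha>[OF s(1)]])
    moreover have "\<exists>x. x \<in> sep (\<alpha> (s, t)) \<and> x \<in> P"
      using P \<alpha>[OF s(1)] unfolding tangle_def orientation_def by (metis imageI)
    ultimately have "\<alpha> (t, s) \<in> P"
      using s(2) by (auto simp: sep_def)
    then show ?thesis
      using s arcs_symmetric by blast
  qed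
  then obtain f where f: "\<And>t. t \<in> pverts T \<Longrightarrow> (t, f t) \<in> parcs T \<and> \<alpha> (t, f t) \<in> P \<and> \<alpha> (f t, t) \<notin> P"
    by metis
  have iter: "(f ^^ i) v \<in> pverts T" if "v \<in> pverts T" for v i
    using that f by (induction i) (auto dest: in_arcsD2)
  obtain v0 where v0: "v0 \<in> pverts T"
    using conn by (auto simp: connected_def strongly_connected_def mk_symmetric_def)
  have "\<not> inj (\<lambda>i. (f ^^ i) v0)"
  proof
    assume "inj (\<lambda>i. (f ^^ i) v0)"
    then have "infinite (range (\<lambda>i. (f ^^ i) v0))"
      by (rule range_inj_infinite)
    moreover have "range (\<lambda>i. (f ^^ i) v0) \<subseteq> pverts T"
      using iter[OF v0] by (rule image_subsetI)
    then have "finite (range (\<lambda>i. (f ^^ i) v0))"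
      by (rule finite_subset[OF _ pair_finite_verts])
    ultimately show False
      by contradiction
  qed
  then obtain i j where ij: "i < j" "(f ^^ i) v0 = (f ^^ j) v0"
    unfolding inj_on_def by (metis nat_neq_iff)
  have shift: "(f ^^ (j - i)) ((f ^^ i) w) = (f ^^ j) w" if "i \<le> j" for i j w
    using that by (metis comp_apply funpow_add le_add_diff_inverse2)
  have "(f ^^ (j - i)) ((f ^^ i) v0) = (f ^^ i) v0"
    using shift[of i j v0] ij by simp
  then have "0 < j - i \<and> (\<exists>v\<in>pverts T. (f ^^ (j - i)) v = v)"
    using iter[OF v0, of i] ij(1) zero_less_diff by metis
  \<comment> \<open>The shortest period over all nodes, so that its orbit repeats no node.\<close>
  define n where "n = (LEAST n. 0 < n \<and> (\<exists>v\<in>pverts T. (f ^^ n) v = v))"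
  have "0 < n \<and> (\<exists>v\<in>pverts T. (f ^^ n) v = v)"
    unfolding n_def by (rule LeastI) fact
  then obtain v where n: "0 < n" and v: "v \<in> pverts T" "(f ^^ n) v = v"
    by blast
  have least: "n \<le> k" if "0 < k" "w \<in> pverts T" "(f ^^ k) w = w" for k w
    unfolding n_def using that by (intro Least_le) auto
  have neq: "(f ^^ i) v \<noteq> (f ^^ j) v" if "i < j" "j < n" for i j
  proof
    assume "(f ^^ i) v = (f ^^ j) v"
    then show False
      using least[of "j - i" "(f ^^ i) v"] that iter[OF v(1)] shift[of i j v] by auto
  qed
  have "inj_on (\<lambda>i. (f ^^ i) v) {..<n}"
    using neq by (metis (no_types, lifting) inj_onI lessThan_iff nat_neq_iff)
  moreover have arcs: "((f ^^ i) v, (f ^^ Suc i) v) \<in> parcs T" for i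
    using f iter[OF v(1)] by simp
  ultimately have "cycle (map (\<lambda>i. ((f ^^ i) v, (f ^^ Suc i) v)) [0..<n])"
    using cycle_map[of T "\<lambda>i. (f ^^ i) v" n] n v(2) by auto
  moreover have "n \<noteq> 1"
    using no_loops[OF arcs[of 0]] v(2) by auto
  \<comment> \<open>Turning straight back would put the label of the reversed arc in
    \<open>P\<close>, which the choice of \<open>f\<close> excludes.\<close>
  moreover have "n \<noteq> 2"
  proof
    assume "n = 2"
    then have "f (f v) = v"
      using v(2) by (simp add: numeral_2_eq_2)
    moreover have "f v \<in> pverts T"
      using iter[OF v(1), of 1] by simp
    ultimately show False
      using f[of v] f[of "f v"] v(1) by simp
  qed
  ultimately show False
    using acyclic n by fastforce
qed

theorem theorem4:
  fixes S :: "'a::universe set" and F :: "'a set set"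
  assumes "finite S"
    and "separation_system S"
    and "submodular S"
    and "\<forall>\<sigma>\<in>F. star \<sigma>"
    and "standard S F"
    and "closed_under_shifting S F"
  shows "(\<exists>P. tangle S F P) \<longleftrightarrow>
         \<not> (\<exists>(T :: nat pair_pre_digraph) \<alpha>. S_tree_over S F T \<alpha>)"
proof -
  interpret shifting_closed_stars S F
    using assms by unfold_locales auto
  show ?thesis
    \<comment> \<open>The instance with \<open>{}\<close> covers \<open>{} \<in> F\<close>, where a
      single node is an \<open>S\<close>-tree over \<open>F\<close>.\<close>
    using exists_tangle exists_S_tree_if_contradictory exists_S_tree[of "{}"] no_tangle_if_S_tree
    by blast
qed

end
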